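(* Let $p \ge 2$ and let $(X,d)$ be a complete $CAT_p(0)$ metric space. Let $\Omega$ and $\Delta$ be nonempty, closed and convex subsets of $X$, and let $T:\Omega\cup\Delta\to\Omega\cup\Delta$ be a cyclic orbital contraction mapping. Then: (i) $T$ has a best proximity point $x^*\in\Omega$, i.e. $d(x^*,Tx^* )=dist(\Omega,\Delta)$; (ii) $x^*$ is the unique fixed point of $T^2$; (iii) $\{T^{2n}x\}$ converges to $x^*$ for every $x\in\Omega$; (iv) $Tx^*$ is a best proximity point of $T$ in $\Delta$, and $\{T^{2n}y\}$ converges to $Tx^*$ for every $y\in\Delta$.
   Context: For nonempty subsets $\Omega,\Delta$ of a metric space $(X,d)$, $dist(\Omega,\Delta)=\inf\{d(x,y):x\in\Omega,\ y\in\Delta\}$. Best proximity point: if $T:\Omega\cup\Delta\to\Omega\cup\Delta$ satisfies $T(\Omega)\subset\Delta$ and $T(\Delta)\subset\Omega$, a point $z\in\Omega\cup\Delta$ is a best proximity point of $T$ if $d(z,Tz)=dist(\Omega,\Delta)$. Cyclic orbital contraction: $T:\Omega\cup\Delta\to\Omega\cup\Delta$ is a cyclic orbital contraction mapping if (a) $T$ induces bounded orbits, i.e. for every $x\in\Omega\cup\Delta$ the orbit $\{T^nx:n\in\mathbb{N}\cup\{0\}\}$ is bounded ($T^0$ is the identity); (b) $T(\Omega)\subset\Delta$ and $T(\Delta)\subset\Omega$; (c) there is $\eta\in(0,1)$ such that for all $x\in\Omega$ and $y\in\Delta$, $$d(Tx,Ty)\le \eta\, S(x,y)+(1-\eta)\,dist(\Omega,\Delta),$$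 where $S(x,y)$ is the supremum of all the numbers $d(T^ix,T^jx)$ with $i-j$ odd, $d(T^ky,T^ly)$ with $k-l$ odd, and $d(T^rx,T^sy)$ with $r-s$ even, all indices ranging over $\mathbb{N}\cup\{0\}$. Geodesics: a geodesic in $(X,d)$ joining $u$ to $v$ is a path $\chi:[0,1]\to X$ with $\chi(0)=u$, $\chi(1)=v$ and $d(\chi(s),\chi(t))=|s-t|\,d(u,v)$ for all $s,t\in[0,1]$; its image is denoted $[u,v]$. $X$ is a geodesic space if every two points are joined by at least one geodesic. A subset $M\subset X$ is convex if $[u,v]\subset M$ for all $u,v\in M$. $CAT_p(0)$ space ($p\ge2$): a geodesic triangle in a geodesic space consists of three vertices $u,v,w\in X$ and a geodesic segment between each pair of vertices. A comparison triangle for it is a triangle with vertices $\bar u,\bar v,\bar w$ in the Banach space $\ell_p$ with $\|\bar u-\bar v\|=d(u,v)$, $\|\bar v-\bar w\|=d(v,w)$, $\|\bar u-\bar w\|=d(u,w)$ (its sides being the linear segments). A point $\bar\xi\in[\bar u,\bar v]$ is the comparison point of $\xi\in[u,v]$ if $\|\bar u-\bar\xi\|=d(u,\xi)$, and similarly for the other sides. A geodesic metric space $(X,d)$ is a $CAT_p(0)$ space if for every geodesic triangle in $X$ there exists a comparison triangle in $\ell_p$ such that $d(a,b)\le\|\bar a-\bar b\|$ for all points $a,b$ of the triangle with comparison points $\bar a,\bar b$.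
   Formalization: In (ii), x* is shown to be the unique fixed point of T^2 in Ω only; uniqueness in Ω∪Δ is false when dist(Ω,Δ)>0, since Tx* in Δ is then another fixed point of T^2 (e.g. Ω={0}, Δ={1}, T swapping the two points). *)

theory Defs
  imports "HOL-Analysis.Analysis"
begin

text \<open>The real Banach space l_p, as a set of sequences.\<close>

definition lp_space :: "real \<Rightarrow> (nat \<Rightarrow> real) set" where
  "lp_space p = {x. summable (\<lambda>n. \<bar>x n\<bar> powr p)}"

definition lp_norm :: "real \<Rightarrow> (nat \<Rightarrow> real) \<Rightarrow> real" where
  "lp_norm p x = (\<Sum>n. \<bar>x n\<bar> powr p) powr (1 / p)"

definition lp_dist :: "real \<Rightarrow> (nat \<Rightarrow> real) \<Rightarrow> (nat \<Rightarrow> real) \<Rightarrow> real" where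
  "lp_dist p x y = lp_norm p (\<lambda>n. x n - y n)"

definition seq_segment :: "(nat \<Rightarrow> real) \<Rightarrow> (nat \<Rightarrow> real) \<Rightarrow> (nat \<Rightarrow> real) set" where
  "seq_segment x y = {(\<lambda>n. (1 - t) * x n + t * y n) | t. 0 \<le> t \<and> t \<le> 1}"

definition geodesic_path :: "'a::metric_space \<Rightarrow> 'a \<Rightarrow> (real \<Rightarrow> 'a) \<Rightarrow> bool" where
  "geodesic_path u v \<gamma> \<longleftrightarrow> \<gamma> 0 = u \<and> \<gamma> 1 = v \<and>
     (\<forall>s\<in>{0..1}. \<forall>t\<in>{0..1}. dist (\<gamma> s) (\<gamma> t) = \<bar>s - t\<bar> * dist u v)"

definition geodesic_segment :: "'a::metric_space \<Rightarrow> 'a \<Rightarrow> 'a set \<Rightarrow> bool" where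
  "geodesic_segment u v S \<longleftrightarrow> (\<exists>\<gamma>. geodesic_path u v \<gamma> \<and> S = \<gamma> ` {0..1})"

definition geodesic_space :: "'a::metric_space itself \<Rightarrow> bool" where
  "geodesic_space _ \<longleftrightarrow> (\<forall>u v :: 'a. \<exists>\<gamma>. geodesic_path u v \<gamma>)"

text \<open>Geodesics need not be unique in a general metric space, so convexity asks for every
  segment joining two points of the set.\<close>

definition geodesically_convex :: "'a::metric_space set \<Rightarrow> bool" where
  "geodesically_convex M \<longleftrightarrow> (\<forall>u\<in>M. \<forall>v\<in>M. \<forall>S. geodesic_segment u v S \<longrightarrow> S \<subseteq> M)"

definition geodesic_triangle ::
    "'a::metric_space \<Rightarrow> 'a \<Rightarrow> 'a \<Rightarrow> 'a set \<Rightarrow> 'a set \<Rightarrow> 'a set \<Rightarrow> bool" where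
  "geodesic_triangle u v w Suv Svw Suw \<longleftrightarrow>
     geodesic_segment u v Suv \<and> geodesic_segment v w Svw \<and> geodesic_segment u w Suw"

definition comparison_triangle ::
    "real \<Rightarrow> 'a::metric_space \<Rightarrow> 'a \<Rightarrow> 'a \<Rightarrow>
     (nat \<Rightarrow> real) \<Rightarrow> (nat \<Rightarrow> real) \<Rightarrow> (nat \<Rightarrow> real) \<Rightarrow> bool" where
  "comparison_triangle p u v w u' v' w' \<longleftrightarrow>
     u' \<in> lp_space p \<and> v' \<in> lp_space p \<and> w' \<in> lp_space p \<and>
     lp_dist p u' v' = dist u v \<and> lp_dist p v' w' = dist v w \<and> lp_dist p u' w' = dist u w"

definition comparison_on_side ::
    "real \<Rightarrow> 'a::metric_space \<Rightarrow> 'a set \<Rightarrow> (nat \<Rightarrow> real) \<Rightarrow> (nat \<Rightarrow> real) \<Rightarrow>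
     'a \<Rightarrow> (nat \<Rightarrow> real) \<Rightarrow> bool" where
  "comparison_on_side p u S u' v' \<xi> \<xi>' \<longleftrightarrow>
     \<xi> \<in> S \<and> \<xi>' \<in> seq_segment u' v' \<and> lp_dist p u' \<xi>' = dist u \<xi>"

text \<open>Being a comparison point is a relation, not a function: a point lying on several sides has
  a comparison point for each of them.\<close>

definition comparison_point ::
    "real \<Rightarrow> 'a::metric_space \<Rightarrow> 'a \<Rightarrow> 'a set \<Rightarrow> 'a set \<Rightarrow> 'a set \<Rightarrow>
     (nat \<Rightarrow> real) \<Rightarrow> (nat \<Rightarrow> real) \<Rightarrow> (nat \<Rightarrow> real) \<Rightarrow> 'a \<Rightarrow> (nat \<Rightarrow> real) \<Rightarrow> bool" where
  "comparison_point p u v Suv Svw Suw u' v' w' \<xi> \<xi>' \<longleftrightarrow>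
     comparison_on_side p u Suv u' v' \<xi> \<xi>' \<or>
     comparison_on_side p v Svw v' w' \<xi> \<xi>' \<or>
     comparison_on_side p u Suw u' w' \<xi> \<xi>'"

definition CAT_p0_space :: "real \<Rightarrow> 'a::metric_space itself \<Rightarrow> bool" where
  "CAT_p0_space p X \<longleftrightarrow> geodesic_space X \<and>
     (\<forall>(u::'a) v w Suv Svw Suw. geodesic_triangle u v w Suv Svw Suw \<longrightarrow>
        (\<exists>u' v' w'. comparison_triangle p u v w u' v' w' \<and>
           (\<forall>a b a' b'.
              comparison_point p u v Suv Svw Suw u' v' w' a a' \<longrightarrow>
              comparison_point p u v Suv Svw Suw u' v' w' b b' \<longrightarrow>
              dist a b \<le> lp_dist p a' b')))"

definition orbital_sup :: "('a::metric_space \<Rightarrow> 'a) \<Rightarrow> 'a \<Rightarrow> 'a \<Rightarrow> real" where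
  "orbital_sup T x y = Sup (
     {dist ((T ^^ i) x) ((T ^^ j) x) | i j. odd (int i - int j)} \<union>
     {dist ((T ^^ k) y) ((T ^^ l) y) | k l. odd (int k - int l)} \<union>
     {dist ((T ^^ r) x) ((T ^^ s) y) | r s. even (int r - int s)})"

text \<open>A map from \<open>\<Omega> \<union> \<Delta>\<close> to itself is represented by a total function, whose values outside
  \<open>\<Omega> \<union> \<Delta>\<close> are irrelevant. By (a), the set in \<^const>\<open>orbital_sup\<close> is bounded for the points
  it is applied to, so that its \<open>Sup\<close> is the supremum.\<close>

definition cyclic_orbital_contraction ::
    "'a::metric_space set \<Rightarrow> 'a set \<Rightarrow> ('a \<Rightarrow> 'a) \<Rightarrow> bool" where
  "cyclic_orbital_contraction \<Omega> \<Delta> T \<longleftrightarrow>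
     (\<forall>x\<in>\<Omega> \<union> \<Delta>. bounded (range (\<lambda>n. (T ^^ n) x))) \<and>
     T ` \<Omega> \<subseteq> \<Delta> \<and> T ` \<Delta> \<subseteq> \<Omega> \<and>
     (\<exists>\<eta>. 0 < \<eta> \<and> \<eta> < 1 \<and>
        (\<forall>x\<in>\<Omega>. \<forall>y\<in>\<Delta>.
           dist (T x) (T y) \<le> \<eta> * orbital_sup T x y + (1 - \<eta>) * setdist \<Omega> \<Delta>))"

definition best_proximity_point ::
    "'a::metric_space set \<Rightarrow> 'a set \<Rightarrow> ('a \<Rightarrow> 'a) \<Rightarrow> 'a \<Rightarrow> bool" where
  "best_proximity_point \<Omega> \<Delta> T z \<longleftrightarrow> z \<in> \<Omega> \<union> \<Delta> \<and> dist z (T z) = setdist \<Omega> \<Delta>"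

end

theory Submission
  imports Defs
begin

text \<open>Iterating the contraction over the orbits of \<open>x \<in> \<Omega>\<close> and \<open>y \<in> \<Delta>\<close> makes the distances
  from \<open>T\<^sup>2\<^sup>n x\<close> to \<open>T\<^sup>2\<^sup>m y\<close> tend to \<open>setdist \<Omega> \<Delta>\<close>. Clarkson's inequality passes from the
  comparison triangle to the space, and applied to midpoints it makes \<open>T\<^sup>2\<^sup>n x\<close> a Cauchy
  sequence whose limit does not depend on \<open>x\<close>. Although \<open>T\<close> need not be continuous, the limit
  is also the limit of its own even iterates. Hence the largest distance between the even and the
  odd part of its orbit is attained up to \<open>\<epsilon>\<close> on images under \<open>T\<close>, and the contraction forces
  it to be \<open>setdist \<Omega> \<Delta>\<close>.\<close>

section \<open>Clarkson's inequality in l_p\<close>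

lemma powr_superadditive:
  fixes x y q :: real
  assumes "x \<ge> 0" "y \<ge> 0" "q \<ge> 1"
  shows "x powr q + y powr q \<le> (x + y) powr q"
proof (cases "x + y = 0")
  case True
  then show ?thesis using assms by (simp add: add_nonneg_eq_0_iff)
next
  case False
  then have pos: "x + y > 0" using assms by linarith
  \<comment> \<open>Only the factor \<open>z powr (q - 1)\<close> is enlarged, by monotonicity; the
    linear factors then add up to \<open>x + y\<close>.\<close>
  have split: "z powr q = z * z powr (q - 1)" if "z \<ge> 0" for z :: real
    using that assms(3) powr_add[of z 1 "q - 1"] by (cases "z = 0") auto
  have "x powr q + y powr q = x * x powr (q - 1) + y * y powr (q - 1)"
    using assms by (simp add: split)
  also have "\<dots> \<le> x * (x + y) powr (q - 1) + y * (x + y) powr (q - 1)"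
    using assms by (intro add_mono mult_left_mono powr_mono2) auto
  also have "\<dots> = (x + y) powr q"
    using split[of "x + y"] pos by (simp add: algebra_simps)
  finally show ?thesis .
qed

lemma powr_midpoint_le:
  fixes x y q :: real
  assumes "x \<ge> 0" "y \<ge> 0" "q \<ge> 1"
  shows "((x + y) / 2) powr q \<le> (x powr q + y powr q) / 2"
\<comment> \<open>If one argument vanishes, the claim reduces to \<open>2 \<le> 2 powr q\<close>;
  for positive arguments it is convexity of the power.\<close>
proof (cases "x = 0 \<or> y = 0")
  case True
  have "(z / 2) powr q \<le> z powr q / 2" if "z \<ge> 0" for z :: real
  proof -
    have "2 powr 1 \<le> (2::real) powr q" using assms(3) by (intro powr_mono) auto
    then have "z powr q / 2 powr q \<le> z powr q / 2" by (intro divide_left_mono) auto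
    then show ?thesis using that by (simp add: powr_divide)
  qed
  then show ?thesis using True assms by auto
next
  case False
  then show ?thesis
    using convex_onD[OF powr_convex[OF assms(3)], of "1/2" x y] assms by (simp add: field_simps)
qed

text \<open>Writing p-th powers as powers \<open>p / 2 \<ge> 1\<close> of squares reduces this to
  the parallelogram identity, with superadditivity before it and convexity after it.\<close>

lemma clarkson_real:
  fixes a b p :: real
  assumes "p \<ge> 2"
  shows "\<bar>(a + b) / 2\<bar> powr p + \<bar>(a - b) / 2\<bar> powr p \<le> (\<bar>a\<bar> powr p + \<bar>b\<bar> powr p) / 2"
proof -
  have sq: "\<bar>z\<bar> powr p = (z\<^sup>2) powr (p / 2)" for z :: real
    using powr_powr[of "\<bar>z\<bar>" 2 "p / 2"] by (cases "z = 0") auto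
  have "\<bar>(a + b) / 2\<bar> powr p + \<bar>(a - b) / 2\<bar> powr p
      \<le> (((a + b) / 2)\<^sup>2 + ((a - b) / 2)\<^sup>2) powr (p / 2)"
    unfolding sq using assms by (intro powr_superadditive) auto
  also have "((a + b) / 2)\<^sup>2 + ((a - b) / 2)\<^sup>2 = (a\<^sup>2 + b\<^sup>2) / 2"
    by (simp add: power2_eq_square field_simps)
  also have "\<dots> powr (p / 2) \<le> (\<bar>a\<bar> powr p + \<bar>b\<bar> powr p) / 2"
    unfolding sq using assms by (intro powr_midpoint_le) auto
  finally show ?thesis .
qed

lemma lp_norm_powr:
  assumes "p \<ge> 2" "x \<in> lp_space p"
  shows "lp_norm p x powr p = (\<Sum>n. \<bar>x n\<bar> powr p)"
proof -
  have "(\<Sum>n. \<bar>x n\<bar> powr p) \<ge> 0"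
    using assms(2) by (intro suminf_nonneg) (auto simp: lp_space_def)
  then show ?thesis using assms(1) by (simp add: lp_norm_def powr_powr)
qed

lemma lp_space_scale:
  assumes "x \<in> lp_space p"
  shows "(\<lambda>n. c * x n) \<in> lp_space p"
  using assms by (auto simp: lp_space_def abs_mult powr_mult intro: summable_mult)

lemma lp_norm_scale:
  assumes "p \<ge> 2" "x \<in> lp_space p"
  shows "lp_norm p (\<lambda>n. c * x n) = \<bar>c\<bar> * lp_norm p x"
  using assms
  by (simp add: lp_norm_def lp_space_def abs_mult powr_mult suminf_mult suminf_nonneg powr_powr)

lemma lp_space_half_sum_diff:
  assumes "p \<ge> 2" "x \<in> lp_space p" "y \<in> lp_space p"
  shows "(\<lambda>n. (x n + y n) / 2) \<in> lp_space p" "(\<lambda>n. (x n - y n) / 2) \<in> lp_space p"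
proof -
  have s: "summable (\<lambda>n. (\<bar>x n\<bar> powr p + \<bar>y n\<bar> powr p) / 2)"
    using assms by (auto simp: lp_space_def intro: summable_divide summable_add)
  \<comment> \<open>Both terms on the left of \<open>clarkson_real\<close> are nonnegative, so each
    alone is dominated by the right side, which is summable.\<close>
  have "\<bar>(x n + y n) / 2\<bar> powr p \<le> (\<bar>x n\<bar> powr p + \<bar>y n\<bar> powr p) / 2"
    "\<bar>(x n - y n) / 2\<bar> powr p \<le> (\<bar>x n\<bar> powr p + \<bar>y n\<bar> powr p) / 2" for n
    using clarkson_real[OF assms(1), of "x n" "y n"] powr_ge_zero[of "\<bar>(x n + y n) / 2\<bar>" p]
      powr_ge_zero[of "\<bar>(x n - y n) / 2\<bar>" p] by linarith+
  then show "(\<lambda>n. (x n + y n) / 2) \<in> lp_space p" "(\<lambda>n. (x n - y n) / 2) \<in> lp_space p"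
    unfolding lp_space_def mem_Collect_eq
    by (auto intro!: summable_comparison_test'[OF s, of 0])
qed

lemma lp_space_diff:
  assumes "p \<ge> 2" "x \<in> lp_space p" "y \<in> lp_space p"
  shows "(\<lambda>n. x n - y n) \<in> lp_space p"
  using lp_space_scale[OF lp_space_half_sum_diff(2)[OF assms], of 2] by (simp add: diff_divide_distrib)

lemma clarkson_lp:
  assumes p: "p \<ge> 2" and x: "x \<in> lp_space p" and y: "y \<in> lp_space p"
  shows "lp_norm p (\<lambda>n. (x n + y n) / 2) powr p + lp_norm p (\<lambda>n. (x n - y n) / 2) powr p
    \<le> (lp_norm p x powr p + lp_norm p y powr p) / 2"
proof -
  note h = lp_space_half_sum_diff[OF p x y]
  have s: "summable (\<lambda>n. \<bar>x n\<bar> powr p)" "summable (\<lambda>n. \<bar>y n\<bar> powr p)"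
    "summable (\<lambda>n. \<bar>(x n + y n) / 2\<bar> powr p)" "summable (\<lambda>n. \<bar>(x n - y n) / 2\<bar> powr p)"
    using x y h by (auto simp: lp_space_def)
  have "(\<Sum>n. \<bar>(x n + y n) / 2\<bar> powr p + \<bar>(x n - y n) / 2\<bar> powr p)
      \<le> (\<Sum>n. (\<bar>x n\<bar> powr p + \<bar>y n\<bar> powr p) / 2)"
    using s by (intro suminf_le clarkson_real p summable_add summable_divide)
  then show ?thesis
    using s unfolding lp_norm_powr[OF p x] lp_norm_powr[OF p y] lp_norm_powr[OF p h(1)]
      lp_norm_powr[OF p h(2)]
    by (simp only: suminf_add[symmetric] suminf_divide summable_add)
qed

section \<open>Midpoints in CAT_p(0) spaces\<close>

text \<open>In the comparison triangle \<open>clarkson_lp\<close> is applied to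
  \<open>u' - w'\<close> and \<open>v' - w'\<close>: half their sum joins \<open>w'\<close> to the
  midpoint of \<open>u'\<close> and \<open>v'\<close>, and half their difference has norm
  \<open>dist u v / 2\<close>. Comparison is needed only between the midpoint and
  \<open>w\<close>.\<close>

lemma CAT_p0_midpoint:
  fixes u v w :: "'a::metric_space"
  assumes p: "p \<ge> 2" and cat: "CAT_p0_space p TYPE('a)" and \<gamma>: "geodesic_path u v \<gamma>"
  shows "dist (\<gamma> (1/2)) w powr p + (dist u v / 2) powr p
    \<le> (dist u w powr p + dist v w powr p) / 2"
proof -
  have "geodesic_space TYPE('a)" using cat by (simp add: CAT_p0_space_def)
  then obtain \<gamma>1 \<gamma>2 where \<gamma>12: "geodesic_path v w \<gamma>1" "geodesic_path u w \<gamma>2"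
    unfolding geodesic_space_def by metis
  define S1 S2 S3 where "S1 = \<gamma> ` {0..1}" and "S2 = \<gamma>1 ` {0..1}" and "S3 = \<gamma>2 ` {0..1}"
  have "geodesic_triangle u v w S1 S2 S3"
    using \<gamma> \<gamma>12 unfolding geodesic_triangle_def geodesic_segment_def S1_def S2_def S3_def by blast
  then obtain u' v' w' where cmp: "comparison_triangle p u v w u' v' w'"
    and le: "\<And>a b a' b'. comparison_point p u v S1 S2 S3 u' v' w' a a' \<Longrightarrow>
      comparison_point p u v S1 S2 S3 u' v' w' b b' \<Longrightarrow> dist a b \<le> lp_dist p a' b'"
    using cat unfolding CAT_p0_space_def by blast
  have lp: "u' \<in> lp_space p" "v' \<in> lp_space p" "w' \<in> lp_space p"
    and d: "lp_dist p u' v' = dist u v" "lp_dist p v' w' = dist v w" "lp_dist p u' w' = dist u w"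
    using cmp by (auto simp: comparison_triangle_def)
  define m' where "m' = (\<lambda>n. (1 - 1/2) * u' n + 1/2 * v' n)"
  have half: "lp_norm p (\<lambda>n. (u' n - v' n) / 2) = dist u v / 2"
    using lp_norm_scale[OF p lp_space_diff[OF p lp(1,2)], of "1/2"] d(1)
    by (simp add: lp_dist_def)
  have "m' \<in> seq_segment u' v'"
    unfolding seq_segment_def m'_def by (intro CollectI exI[of _ "1/2"]) simp
  moreover have "lp_dist p u' m' = dist u (\<gamma> (1/2))"
  proof -
    have "(\<lambda>n. u' n - m' n) = (\<lambda>n. (u' n - v' n) / 2)"
      by (simp add: m'_def fun_eq_iff field_simps)
    moreover have "\<forall>s\<in>{0..1}. \<forall>t\<in>{0..1}. dist (\<gamma> s) (\<gamma> t) = \<bar>s - t\<bar> * dist u v"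
      using \<gamma> by (simp add: geodesic_path_def)
    from this[rule_format, of 0 "1/2"] have "dist (\<gamma> 0) (\<gamma> (1/2)) = dist u v / 2" by simp
    ultimately show ?thesis using half \<gamma> by (simp add: lp_dist_def geodesic_path_def)
  qed
  ultimately have cm: "comparison_point p u v S1 S2 S3 u' v' w' (\<gamma> (1/2)) m'"
    by (simp add: comparison_point_def comparison_on_side_def S1_def)
  \<comment> \<open>The vertex \<open>w\<close> is treated as the end of the side from
    \<open>v\<close> to \<open>w\<close>, with parameter 1.\<close>
  have "w' \<in> seq_segment v' w'"
    unfolding seq_segment_def by (auto intro!: exI[of _ "1::real"])
  moreover have "w \<in> S2" using \<gamma>12(1) by (force simp: S2_def geodesic_path_def)
  ultimately have cw: "comparison_point p u v S1 S2 S3 u' v' w' w w'"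
    using d(2) by (simp add: comparison_point_def comparison_on_side_def)
  let ?x = "\<lambda>n. u' n - w' n" and ?y = "\<lambda>n. v' n - w' n"
  have eqs: "(\<lambda>n. m' n - w' n) = (\<lambda>n. (?x n + ?y n) / 2)"
    "(\<lambda>n. (u' n - v' n) / 2) = (\<lambda>n. (?x n - ?y n) / 2)"
    by (simp_all add: m'_def fun_eq_iff field_simps)
  have "dist (\<gamma> (1/2)) w powr p \<le> lp_dist p m' w' powr p"
    using le[OF cm cw] p by (intro powr_mono2) auto
  moreover have "lp_dist p m' w' powr p + (dist u v / 2) powr p
      \<le> (dist u w powr p + dist v w powr p) / 2"
    using clarkson_lp[OF p lp_space_diff[OF p lp(1,3)] lp_space_diff[OF p lp(2,3)]]
    unfolding eqs[symmetric] half using d(2,3) by (simp add: lp_dist_def)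
  ultimately show ?thesis by linarith
qed

text \<open>This is the property UC of the pair \<open>(\<Omega>, \<Delta>)\<close>: the midpoint of \<open>u\<close> and \<open>v\<close> stays in the
  convex set \<open>\<Omega>\<close>, hence at distance at least \<open>setdist \<Omega> \<Delta>\<close> from \<open>w\<close>.\<close>

lemma CAT_p0_property_UC:
  fixes \<Omega> \<Delta> :: "'a::metric_space set"
  assumes p: "p \<ge> 2" and cat: "CAT_p0_space p TYPE('a)"
    and conv: "geodesically_convex \<Omega>" and e: "e > 0"
  obtains \<delta> where "\<delta> > 0"
    "\<And>u v w. \<lbrakk>u \<in> \<Omega>; v \<in> \<Omega>; w \<in> \<Delta>; dist u w < setdist \<Omega> \<Delta> + \<delta>;
      dist v w < setdist \<Omega> \<Delta> + \<delta>\<rbrakk> \<Longrightarrow> dist u v < e"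
proof -
  define D where "D = setdist \<Omega> \<Delta>"
  have D0: "D \<ge> 0" by (simp add: D_def setdist_pos_le)
  \<comment> \<open>The midpoint inequality will bound \<open>(dist u v / 2) powr p\<close> by
    \<open>(D + \<delta>) powr p - D powr p\<close>, so \<delta> is chosen by continuity to make
    this less than \<open>(e / 2) powr p\<close>. The limit from the right keeps the base
    nonnegative even if \<open>D = 0\<close>.\<close>
  have "((\<lambda>t. (D + t) powr p) \<longlongrightarrow> (D + 0) powr p) (at_right 0)"
    using p D0 by (intro tendsto_intros tendsto_powr2)
      (auto simp: eventually_at_right_less intro: eventually_mono[OF eventually_at_right_less])
  moreover have "D powr p < D powr p + (e / 2) powr p" using e by simp
  ultimately have "eventually (\<lambda>t. (D + t) powr p < D powr p + (e / 2) powr p) (at_right 0)"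
    by (intro order_tendstoD(2)) auto
  then have "eventually (\<lambda>t. t > 0 \<and> (D + t) powr p < D powr p + (e / 2) powr p) (at_right 0)"
    by (intro eventually_conj eventually_at_right_less)
  then obtain \<delta> where \<delta>: "\<delta> > 0" "(D + \<delta>) powr p < D powr p + (e / 2) powr p"
    using eventually_happens'[OF trivial_limit_at_right_real] by blast
  show thesis
  proof (rule that[OF \<delta>(1)])
    fix u v w
    assume u: "u \<in> \<Omega>" and v: "v \<in> \<Omega>" and w: "w \<in> \<Delta>"
      and uw: "dist u w < setdist \<Omega> \<Delta> + \<delta>" and vw: "dist v w < setdist \<Omega> \<Delta> + \<delta>"
    obtain \<gamma> where \<gamma>: "geodesic_path u v \<gamma>"
      using cat unfolding CAT_p0_space_def geodesic_space_def by blast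
    have "\<gamma> ` {0..1} \<subseteq> \<Omega>"
      using conv u v \<gamma> unfolding geodesically_convex_def geodesic_segment_def by blast
    moreover have "\<gamma> (1/2) \<in> \<gamma> ` {0..1}" by (rule imageI) simp
    ultimately have "D \<le> dist (\<gamma> (1/2)) w"
      unfolding D_def using w by (intro setdist_le_dist) auto
    then have "D powr p \<le> dist (\<gamma> (1/2)) w powr p"
      using D0 p by (intro powr_mono2) auto
    moreover have "dist u w powr p \<le> (D + \<delta>) powr p" "dist v w powr p \<le> (D + \<delta>) powr p"
      using uw vw p by (intro powr_mono2; simp add: D_def)+
    ultimately have "(dist u v / 2) powr p < (e / 2) powr p"
      using CAT_p0_midpoint[OF p cat \<gamma>, of w] \<delta>(2) by argo
    then show "dist u v < e"
      using powr_mono2[of p "e / 2" "dist u v / 2"] p e by (cases "dist u v < e") auto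
  qed
qed

section \<open>Iterating the orbital contraction\<close>

text \<open>The contraction condition for a pair of sets that \<open>T\<close> interchanges, in place of the orbits;
  in this form the roles of \<open>\<Omega>\<close> and \<open>\<Delta>\<close> are symmetric and the condition iterates.\<close>

definition orbital_contraction_on ::
    "'a::metric_space set \<Rightarrow> 'a set \<Rightarrow> ('a \<Rightarrow> 'a) \<Rightarrow> real \<Rightarrow> bool" where
  "orbital_contraction_on \<Omega> \<Delta> T \<eta> \<longleftrightarrow>
     (\<forall>A B M. A \<subseteq> \<Omega> \<longrightarrow> B \<subseteq> \<Delta> \<longrightarrow> T ` A \<subseteq> B \<longrightarrow> T ` B \<subseteq> A \<longrightarrow>
        (\<forall>a\<in>A. \<forall>b\<in>B. dist a b \<le> M) \<longrightarrow>
        (\<forall>a\<in>A. \<forall>b\<in>B. dist (T a) (T b) \<le> \<eta> * M + (1 - \<eta>) * setdist \<Omega> \<Delta>))"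

lemma funpow_interchange:
  assumes "T ` A \<subseteq> B" "T ` B \<subseteq> A"
  shows "x \<in> A \<Longrightarrow> (T ^^ n) x \<in> (if even n then A else B)"
    and "x \<in> B \<Longrightarrow> (T ^^ n) x \<in> (if even n then B else A)"
  using assms by (induction n) (auto split: if_splits)

text \<open>The parity conditions in \<open>orbital_sup\<close> select exactly the pairs of iterates
  that \<open>funpow_interchange\<close> places on opposite sides, one in \<open>A\<close> and one
  in \<open>B\<close>. Hence \<open>M\<close> bounds the supremum.\<close>

lemma cyclic_orbital_contraction_on:
  assumes "cyclic_orbital_contraction \<Omega> \<Delta> T"
  obtains \<eta> where "0 < \<eta>" "\<eta> < 1" "orbital_contraction_on \<Omega> \<Delta> T \<eta>"
proof -
  obtain \<eta> where \<eta>: "0 < \<eta>" "\<eta> < 1"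
    and c: "\<And>x y. x \<in> \<Omega> \<Longrightarrow> y \<in> \<Delta> \<Longrightarrow>
      dist (T x) (T y) \<le> \<eta> * orbital_sup T x y + (1 - \<eta>) * setdist \<Omega> \<Delta>"
    using assms unfolding cyclic_orbital_contraction_def by blast
  have "dist (T a) (T b) \<le> \<eta> * M + (1 - \<eta>) * setdist \<Omega> \<Delta>"
    if sub: "A \<subseteq> \<Omega>" "B \<subseteq> \<Delta>" and T: "T ` A \<subseteq> B" "T ` B \<subseteq> A"
      and M: "\<forall>a\<in>A. \<forall>b\<in>B. dist a b \<le> M" and ab: "a \<in> A" "b \<in> B" for A B M a b
  proof -
    have M': "dist x y \<le> M" if "x \<in> A \<and> y \<in> B \<or> x \<in> B \<and> y \<in> A" for x y
      using M that by (auto simp: dist_commute)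
    note a = funpow_interchange(1)[OF T ab(1)] and b = funpow_interchange(2)[OF T ab(2)]
    have "orbital_sup T a b \<le> M"
      unfolding orbital_sup_def
    proof (rule cSup_least)
      show "{dist ((T ^^ i) a) ((T ^^ j) a) | i j. odd (int i - int j)} \<union>
        {dist ((T ^^ k) b) ((T ^^ l) b) | k l. odd (int k - int l)} \<union>
        {dist ((T ^^ r) a) ((T ^^ s) b) | r s. even (int r - int s)} \<noteq> {}"
        by (auto intro: exI[of _ "0::nat"])
    next
      fix z
      assume "z \<in> {dist ((T ^^ i) a) ((T ^^ j) a) | i j. odd (int i - int j)} \<union>
        {dist ((T ^^ k) b) ((T ^^ l) b) | k l. odd (int k - int l)} \<union>
        {dist ((T ^^ r) a) ((T ^^ s) b) | r s. even (int r - int s)}"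
      then consider i j where "z = dist ((T ^^ i) a) ((T ^^ j) a)" "odd (int i - int j)"
        | i j where "z = dist ((T ^^ i) b) ((T ^^ j) b)" "odd (int i - int j)"
        | i j where "z = dist ((T ^^ i) a) ((T ^^ j) b)" "even (int i - int j)"
        by blast
      then show "z \<le> M"
      proof cases
        case (1 i j)
        then show ?thesis using a[of i] a[of j] by (auto intro!: M' split: if_splits)
      next
        case (2 i j)
        then show ?thesis using b[of i] b[of j] by (auto intro!: M' split: if_splits)
      next
        case (3 i j)
        then show ?thesis using a[of i] b[of j] by (auto intro!: M' split: if_splits)
      qed
    qed
    then have "\<eta> * orbital_sup T a b \<le> \<eta> * M" using \<eta> by simp
    with c[of a b] sub ab show ?thesis by (smt (verit) subsetD)
  qed
  then have "orbital_contraction_on \<Omega> \<Delta> T \<eta>"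
    unfolding orbital_contraction_on_def by blast
  with \<eta> show thesis by (rule that)
qed

text \<open>One application of \<open>T\<close> replaces the excess
  \<open>M - setdist \<Omega> \<Delta>\<close> by \<eta> times itself and moves to the pair of
  images, which again satisfies the hypotheses.\<close>

lemma orbital_contraction_on_funpow:
  assumes c: "orbital_contraction_on \<Omega> \<Delta> T \<eta>"
    and "A \<subseteq> \<Omega>" "B \<subseteq> \<Delta>" "T ` A \<subseteq> B" "T ` B \<subseteq> A"
    and "\<forall>a\<in>A. \<forall>b\<in>B. dist a b \<le> M" "a \<in> A" "b \<in> B"
  shows "dist ((T ^^ n) a) ((T ^^ n) b)
    \<le> setdist \<Omega> \<Delta> + \<eta> ^ n * (M - setdist \<Omega> \<Delta>)"
  using assms(2-)
proof (induction n arbitrary: A B M a b)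
  case 0
  then show ?case by simp
next
  case (Suc n)
  let ?M = "\<eta> * M + (1 - \<eta>) * setdist \<Omega> \<Delta>"
  have step: "\<forall>a\<in>A. \<forall>b\<in>B. dist (T a) (T b) \<le> ?M"
    using c Suc.prems(1-5) unfolding orbital_contraction_on_def by blast
  have "\<forall>x\<in>T ` B. \<forall>y\<in>T ` A. dist x y \<le> ?M"
    using step by auto (metis dist_commute)
  \<comment> \<open>The arguments are swapped because \<open>T b\<close> lies in \<Omega> and
    \<open>T a\<close> in \<Delta>.\<close>
  then have "dist ((T ^^ n) (T b)) ((T ^^ n) (T a))
      \<le> setdist \<Omega> \<Delta> + \<eta> ^ n * (?M - setdist \<Omega> \<Delta>)"
    using Suc.prems by (intro Suc.IH[of "T ` B" "T ` A"]) blast+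
  then show ?case
    by (simp add: dist_commute funpow_swap1 algebra_simps)
qed

lemma even_orbits_dist_near_setdist:
  assumes coc: "cyclic_orbital_contraction \<Omega> \<Delta> T"
    and x: "x \<in> \<Omega>" and y: "y \<in> \<Delta>" and e: "e > 0"
  obtains N where
    "\<And>n m. n \<ge> N \<Longrightarrow> m \<ge> N \<Longrightarrow>
      dist ((T ^^ (2 * n)) x) ((T ^^ (2 * m)) y) < setdist \<Omega> \<Delta> + e"
proof -
  obtain \<eta> where \<eta>: "0 < \<eta>" "\<eta> < 1" and c: "orbital_contraction_on \<Omega> \<Delta> T \<eta>"
    using cyclic_orbital_contraction_on[OF coc] .
  have T: "T ` \<Omega> \<subseteq> \<Delta>" "T ` \<Delta> \<subseteq> \<Omega>"
    and bdd: "bounded (range (\<lambda>n. (T ^^ n) x))" "bounded (range (\<lambda>n. (T ^^ n) y))"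
    using coc x y unfolding cyclic_orbital_contraction_def by auto
  \<comment> \<open>\<open>U\<close> is bounded and invariant under \<open>T\<close>, so
    \<open>T\<close> interchanges its parts in \<Omega> and \<Delta>, and one bound \<open>M\<close>
    serves all iterates of both points.\<close>
  define U where "U = range (\<lambda>n. (T ^^ n) x) \<union> range (\<lambda>n. (T ^^ n) y)"
  have TU: "T ` U \<subseteq> U"
    unfolding U_def by (auto simp: image_iff) (metis funpow.simps(2) comp_apply)+
  have "bounded U" using bdd by (simp add: U_def)
  then obtain M where M: "\<And>a b. a \<in> U \<Longrightarrow> b \<in> U \<Longrightarrow> dist a b \<le> M"
    by (metis bounded_two_points)
  define D where "D = setdist \<Omega> \<Delta>"
  have key: "dist ((T ^^ n) a) ((T ^^ n) b) \<le> D + \<eta> ^ n * (M - D)"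
    if "a \<in> U \<inter> \<Omega>" "b \<in> U \<inter> \<Delta>" for a b n
    unfolding D_def
    by (rule orbital_contraction_on_funpow[OF c, of "U \<inter> \<Omega>" "U \<inter> \<Delta>"])
      (use T TU M that in auto)
  have "(\<lambda>n. D + \<eta> ^ n * (M - D)) \<longlonglongrightarrow> D + 0 * (M - D)"
    using \<eta> by (intro tendsto_intros LIMSEQ_realpow_zero) auto
  then have "eventually (\<lambda>n. D + \<eta> ^ n * (M - D) < D + e) sequentially"
    using e by (intro order_tendstoD(2)) auto
  then obtain N where N: "\<And>n. n \<ge> N \<Longrightarrow> D + \<eta> ^ n * (M - D) < D + e"
    by (auto simp: eventually_sequentially)
  show thesis
  proof (rule that)
    fix n m assume nm: "N \<le> n" "N \<le> m"
    \<comment> \<open>The common exponent \<open>k\<close> is split off from the unequal exponents.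
      What remains is even, so \<open>?a\<close> and \<open>?b\<close> stay on their own sides, and
      \<open>k \<ge> N\<close>.\<close>
    define k where "k = 2 * min n m"
    let ?a = "(T ^^ (2 * (n - min n m))) x" and ?b = "(T ^^ (2 * (m - min n m))) y"
    have "?a \<in> U \<inter> \<Omega>" "?b \<in> U \<inter> \<Delta>"
      using funpow_interchange(1)[OF T x, of "2 * (n - min n m)"]
        funpow_interchange(2)[OF T y, of "2 * (m - min n m)"] by (auto simp: U_def)
    then have "dist ((T ^^ k) ?a) ((T ^^ k) ?b) \<le> D + \<eta> ^ k * (M - D)" by (rule key)
    also have "\<dots> < D + e" using nm by (intro N) (auto simp: k_def)
    also have "(T ^^ k) ?a = (T ^^ (2 * n)) x"
      unfolding k_def
      by (subst funpow_add[symmetric, THEN fun_cong, unfolded o_apply]) (simp add: algebra_simps)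
    also have "(T ^^ k) ?b = (T ^^ (2 * m)) y"
      unfolding k_def
      by (subst funpow_add[symmetric, THEN fun_cong, unfolded o_apply]) (simp add: algebra_simps)
    finally show "dist ((T ^^ (2 * n)) x) ((T ^^ (2 * m)) y) < setdist \<Omega> \<Delta> + e"
      by (simp add: D_def)
  qed
qed

lemma funpow_2_mult_fixed:
  assumes "T (T z) = z"
  shows "(T ^^ (2 * n)) z = z"
  by (induction n) (simp_all add: assms)

theorem theorem2p4:
  fixes p :: real
    and \<Omega> \<Delta> :: "'a::complete_space set"
    and T :: "'a \<Rightarrow> 'a"
  assumes "p \<ge> 2"
    and "CAT_p0_space p TYPE('a)"
    and "\<Omega> \<noteq> {}" and "closed \<Omega>" and "geodesically_convex \<Omega>"
    and "\<Delta> \<noteq> {}" and "closed \<Delta>" and "geodesically_convex \<Delta>"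
    and "cyclic_orbital_contraction \<Omega> \<Delta> T"
  shows "\<exists>xs\<in>\<Omega>.
      best_proximity_point \<Omega> \<Delta> T xs \<and>
      (\<forall>z\<in>\<Omega>. (T ^^ 2) z = z \<longleftrightarrow> z = xs) \<and>
      (\<forall>x\<in>\<Omega>. (\<lambda>n. (T ^^ (2 * n)) x) \<longlonglongrightarrow> xs) \<and>
      (T xs \<in> \<Delta> \<and> best_proximity_point \<Omega> \<Delta> T (T xs)) \<and>
      (\<forall>y\<in>\<Delta>. (\<lambda>n. (T ^^ (2 * n)) y) \<longlonglongrightarrow> T xs)"
proof -
  note p = assms(1) and cat = assms(2) and coc = assms(9)
  define D where "D = setdist \<Omega> \<Delta>"
  have T: "T ` \<Omega> \<subseteq> \<Delta>" "T ` \<Delta> \<subseteq> \<Omega>"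
    and bdd: "\<And>x. x \<in> \<Omega> \<Longrightarrow> bounded (range (\<lambda>n. (T ^^ n) x))"
    using coc unfolding cyclic_orbital_contraction_def by auto
  have even_in: "x \<in> \<Omega> \<Longrightarrow> (T ^^ (2 * n)) x \<in> \<Omega>" "x \<in> \<Delta> \<Longrightarrow> (T ^^ (2 * n)) x \<in> \<Delta>" for x n
    using funpow_interchange[OF T, of x "2 * n"] by auto
  obtain x0 where x0: "x0 \<in> \<Omega>" using assms(3) by blast

  \<comment> \<open>Common limit of the even iterates in \<Omega>\<close>
  have near: "\<exists>N. \<forall>n\<ge>N. \<forall>m\<ge>N. dist ((T ^^ (2 * n)) x) ((T ^^ (2 * m)) x') < e"
    if x: "x \<in> \<Omega>" "x' \<in> \<Omega>" and e: "e > 0" for x x' e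
  proof -
    obtain \<delta> where \<delta>: "\<delta> > 0" "\<And>u v w. \<lbrakk>u \<in> \<Omega>; v \<in> \<Omega>; w \<in> \<Delta>;
        dist u w < setdist \<Omega> \<Delta> + \<delta>; dist v w < setdist \<Omega> \<Delta> + \<delta>\<rbrakk> \<Longrightarrow> dist u v < e"
      using CAT_p0_property_UC[OF p cat assms(5) e] by blast
    have y: "T x0 \<in> \<Delta>" using T x0 by auto
    obtain N1 where N1: "\<And>n m. n \<ge> N1 \<Longrightarrow> m \<ge> N1 \<Longrightarrow>
        dist ((T ^^ (2 * n)) x) ((T ^^ (2 * m)) (T x0)) < setdist \<Omega> \<Delta> + \<delta>"
      using even_orbits_dist_near_setdist[OF coc x(1) y \<delta>(1)] by blast
    obtain N2 where N2: "\<And>n m. n \<ge> N2 \<Longrightarrow> m \<ge> N2 \<Longrightarrow>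
        dist ((T ^^ (2 * n)) x') ((T ^^ (2 * m)) (T x0)) < setdist \<Omega> \<Delta> + \<delta>"
      using even_orbits_dist_near_setdist[OF coc x(2) y \<delta>(1)] by blast
    \<comment> \<open>Both orbits are compared with a single point of \<Delta>, an iterate of
      \<open>T x0\<close> with fixed index, which serves as the \<open>w\<close> of property UC. The
      case \<open>x = x'\<close> gives the Cauchy property, the general case a common limit.\<close>
    show ?thesis
      using N1[of _ "max N1 N2"] N2[of _ "max N1 N2"] x y even_in
      by (intro exI[of _ "max N1 N2"] allI impI \<delta>(2)[where w = "(T ^^ (2 * max N1 N2)) (T x0)"]) auto
  qed
  have "Cauchy (\<lambda>n. (T ^^ (2 * n)) x0)"
    using near[OF x0 x0] unfolding Cauchy_def by blast
  then obtain xs where xs_lim: "(\<lambda>n. (T ^^ (2 * n)) x0) \<longlonglongrightarrow> xs"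
    using Cauchy_convergent convergent_def by blast
  have xs: "xs \<in> \<Omega>"
    using closed_sequentially[OF assms(4) _ xs_lim] even_in x0 by blast
  have lim_\<Omega>: "(\<lambda>n. (T ^^ (2 * n)) x) \<longlonglongrightarrow> xs" if x: "x \<in> \<Omega>" for x
  proof (rule metric_LIMSEQ_I)
    fix e :: real assume e: "e > 0"
    obtain N1 where N1: "\<forall>n\<ge>N1. \<forall>m\<ge>N1. dist ((T ^^ (2 * n)) x) ((T ^^ (2 * m)) x0) < e / 2"
      using near[OF x x0, of "e / 2"] e by auto
    obtain N2 where N2: "\<forall>n\<ge>N2. dist ((T ^^ (2 * n)) x0) xs < e / 2"
      using metric_LIMSEQ_D[OF xs_lim, of "e / 2"] e by auto
    have "dist ((T ^^ (2 * n)) x) xs < e" if "n \<ge> max N1 N2" for n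
    proof (rule dist_triangle_half_l)
      show "dist ((T ^^ (2 * n)) x) ((T ^^ (2 * n)) x0) < e / 2" using N1 that by simp
      show "dist xs ((T ^^ (2 * n)) x0) < e / 2" using N2 that by (simp add: dist_commute)
    qed
    then show "\<exists>N. \<forall>n\<ge>N. dist ((T ^^ (2 * n)) x) xs < e" by blast
  qed

  \<comment> \<open>Even and odd iterates of the limit\<close>
  define A where "A = range (\<lambda>n. (T ^^ (2 * n)) xs)"
  define B where "B = T ` A"
  have A\<Omega>: "A \<subseteq> \<Omega>" and B\<Delta>: "B \<subseteq> \<Delta>" and TA: "T ` A \<subseteq> B"
    using even_in(1)[OF xs] T by (auto simp: A_def B_def)
  have Suc2: "T (T ((T ^^ (2 * n)) xs)) = (T ^^ (2 * Suc n)) xs" for n by simp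
  have TB: "T ` B \<subseteq> A"
    unfolding B_def A_def image_subset_iff ball_simps Suc2 by blast
  \<comment> \<open>Applying \<open>T\<close> twice to \<open>A\<close> can lose only its initial
    point \<open>xs\<close>. That point is recovered as a limit, since \<open>lim_\<Omega>\<close>
    applies to the orbit of \<open>xs\<close> itself; this takes the place of continuity of
    \<open>T\<close>.\<close>
  have "(\<lambda>n. (T ^^ (2 * Suc n)) xs) \<longlonglongrightarrow> xs"
    using lim_\<Omega>[OF xs] by (rule LIMSEQ_Suc)
  moreover have "(T ^^ (2 * Suc n)) xs \<in> T ` B" for n
    unfolding B_def A_def Suc2[symmetric] by blast
  ultimately have "xs \<in> closure (T ` B)"
    unfolding closure_sequential by (intro exI[of _ "\<lambda>n. (T ^^ (2 * Suc n)) xs"]) blast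
  moreover have "A \<subseteq> insert xs (T ` B)"
  proof
    fix a assume "a \<in> A"
    then obtain n where a: "a = (T ^^ (2 * n)) xs" by (auto simp: A_def)
    show "a \<in> insert xs (T ` B)"
    proof (cases n)
      case (Suc m)
      then have "a = T (T ((T ^^ (2 * m)) xs))" using a by simp
      then show ?thesis by (auto simp: B_def A_def)
    qed (simp add: a)
  qed
  ultimately have Acl: "A \<subseteq> closure (T ` B)"
    using closure_subset by blast
  obtain \<eta> where \<eta>: "0 < \<eta>" "\<eta> < 1" and c: "orbital_contraction_on \<Omega> \<Delta> T \<eta>"
    using cyclic_orbital_contraction_on[OF coc] .
  \<comment> \<open>By density of \<open>T ` B\<close> in \<open>A\<close> the contracted bound holds on \<open>A \<times> B\<close> itself.\<close>
  have improve: "\<forall>a\<in>A. \<forall>b\<in>B. dist a b \<le> \<eta> * M + (1 - \<eta>) * D"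
    if M: "\<forall>a\<in>A. \<forall>b\<in>B. dist a b \<le> M" for M
  proof (intro ballI)
    fix a b assume a: "a \<in> A" and b: "b \<in> B"
    obtain a' where a': "a' \<in> A" "b = T a'" using b by (auto simp: B_def)
    \<comment> \<open>Since \<open>b\<close> is already an image under \<open>T\<close>, only the
      other argument needs the passage to the closure, which a closed ball allows.\<close>
    have "T ` B \<subseteq> cball b (\<eta> * M + (1 - \<eta>) * D)"
      using c A\<Omega> B\<Delta> TA TB M a' unfolding orbital_contraction_on_def D_def by auto
    then have "closure (T ` B) \<subseteq> cball b (\<eta> * M + (1 - \<eta>) * D)"
      by (intro closure_minimal) auto
    then show "dist a b \<le> \<eta> * M + (1 - \<eta>) * D"
      using a Acl by (auto simp: dist_commute)
  qed
  have "A \<union> B \<subseteq> range (\<lambda>n. (T ^^ n) xs)"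
    unfolding A_def B_def by (auto intro: rangeI) (metis funpow.simps(2) comp_apply rangeI)
  then have "bounded (A \<union> B)" using bdd[OF xs] bounded_subset by blast
  then obtain M0 where M0: "\<forall>a\<in>A. \<forall>b\<in>B. dist a b \<le> M0"
    by (metis bounded_two_points UnI1 UnI2)
  \<comment> \<open>Here the sets stay fixed while the bound shrinks, so in the limit no distance
    between \<open>A\<close> and \<open>B\<close> exceeds \<open>D\<close>.\<close>
  have iter: "\<forall>a\<in>A. \<forall>b\<in>B. dist a b \<le> D + \<eta> ^ n * (M0 - D)" for n
  proof (induction n)
    case 0
    then show ?case using M0 by simp
  next
    case (Suc n)
    from improve[OF Suc] show ?case by (simp add: algebra_simps)
  qed
  have le_D: "dist a b \<le> D" if "a \<in> A" "b \<in> B" for a b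
  proof (rule LIMSEQ_le_const)
    have "(\<lambda>n. D + \<eta> ^ n * (M0 - D)) \<longlonglongrightarrow> D + 0 * (M0 - D)"
      using \<eta> by (intro tendsto_intros LIMSEQ_realpow_zero) auto
    then show "(\<lambda>n. D + \<eta> ^ n * (M0 - D)) \<longlonglongrightarrow> D" by simp
  qed (use iter that in blast)
  have eq_D: "dist a b = D" if "a \<in> A" "b \<in> B" for a b
  proof (rule antisym[OF le_D[OF that]])
    show "D \<le> dist a b"
      unfolding D_def using that A\<Omega> B\<Delta> by (intro setdist_le_dist) blast+
  qed
  have xsA: "xs \<in> A" "T (T xs) \<in> A"
    using rangeI[of "\<lambda>n. (T ^^ (2 * n)) xs" 0] rangeI[of "\<lambda>n. (T ^^ (2 * n)) xs" 1]
    by (simp_all add: A_def eval_nat_numeral)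
  have Txs: "T xs \<in> B" "T xs \<in> \<Delta>" using xsA xs T by (auto simp: B_def)
  have prox: "dist xs (T xs) = D" "dist (T (T xs)) (T xs) = D"
    using eq_D xsA Txs by auto

  \<comment> \<open>Fixed point of the square of \<open>T\<close>, limits in \<Delta>,
    uniqueness\<close>
  have fix_xs: "T (T xs) = xs"
  proof (rule ccontr)
    assume "T (T xs) \<noteq> xs"
    then have "dist (T (T xs)) xs > 0" by simp
    \<comment> \<open>Both \<open>xs\<close> and \<open>T (T xs)\<close> lie in \<Omega> at distance
      exactly \<open>D\<close> from \<open>T xs\<close>, so property UC with their own distance as
      \<open>e\<close> is contradictory.\<close>
    from CAT_p0_property_UC[OF p cat assms(5) this, of \<Delta>] obtain \<delta> where "\<delta> > 0"
      "\<And>u v w. \<lbrakk>u \<in> \<Omega>; v \<in> \<Omega>; w \<in> \<Delta>; dist u w < setdist \<Omega> \<Delta> + \<delta>;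
        dist v w < setdist \<Omega> \<Delta> + \<delta>\<rbrakk> \<Longrightarrow> dist u v < dist (T (T xs)) xs"
      by blast
    from this(2)[of "T (T xs)" xs "T xs"] show False
      using \<open>\<delta> > 0\<close> prox xs Txs xsA A\<Omega> by (auto simp: D_def)
  qed
  have lim_\<Delta>: "(\<lambda>n. (T ^^ (2 * n)) y) \<longlonglongrightarrow> T xs" if y: "y \<in> \<Delta>" for y
  proof (rule metric_LIMSEQ_I)
    fix e :: real assume e: "e > 0"
    obtain \<delta> where \<delta>: "\<delta> > 0" "\<And>u v w. \<lbrakk>u \<in> \<Delta>; v \<in> \<Delta>; w \<in> \<Omega>;
        dist u w < setdist \<Omega> \<Delta> + \<delta>; dist v w < setdist \<Omega> \<Delta> + \<delta>\<rbrakk> \<Longrightarrow> dist u v < e"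
      using CAT_p0_property_UC[OF p cat assms(8) e, of \<Omega>] by (metis setdist_sym)
    obtain N where N: "\<And>n m. n \<ge> N \<Longrightarrow> m \<ge> N \<Longrightarrow>
        dist ((T ^^ (2 * n)) xs) ((T ^^ (2 * m)) y) < setdist \<Omega> \<Delta> + \<delta>"
      using even_orbits_dist_near_setdist[OF coc xs y \<delta>(1)] by blast
    \<comment> \<open>Now \<Delta> is the convex side and \<open>xs\<close> is the \<open>w\<close>
      of property UC: being fixed by even powers of \<open>T\<close>, it is nearly at distance
      \<open>D\<close> from the late even iterates of \<open>y\<close>, and exactly so from
      \<open>T xs\<close>.\<close>
    have "dist ((T ^^ (2 * n)) y) (T xs) < e" if "n \<ge> N" for n
      using N[OF that that] prox(1) \<delta>(1) y xs Txs even_in(2)[OF y]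
      unfolding funpow_2_mult_fixed[of T xs, OF fix_xs]
      by (intro \<delta>(2)[of _ _ xs]) (auto simp: D_def dist_commute)
    then show "\<exists>N. \<forall>n\<ge>N. dist ((T ^^ (2 * n)) y) (T xs) < e" by blast
  qed
  have uniq: "(T ^^ 2) z = z \<longleftrightarrow> z = xs" if z: "z \<in> \<Omega>" for z
  proof
    assume "(T ^^ 2) z = z"
    then have "T (T z) = z" by (simp add: eval_nat_numeral)
    \<comment> \<open>The even iterates of \<open>z\<close> form a constant sequence, which must
      converge to \<open>xs\<close>.\<close>
    then show "z = xs"
      using lim_\<Omega>[OF z] by (simp add: funpow_2_mult_fixed LIMSEQ_const_iff)
  qed (simp add: fix_xs eval_nat_numeral)
  show ?thesis
  proof (intro bexI[OF _ xs] conjI ballI)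
    show "best_proximity_point \<Omega> \<Delta> T xs" "best_proximity_point \<Omega> \<Delta> T (T xs)"
      using xs Txs prox by (auto simp: best_proximity_point_def D_def fix_xs dist_commute)
  qed (use uniq lim_\<Omega> lim_\<Delta> Txs in auto)
qed

end
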